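(* If the sequent $\Omega\vdash C_r$ is derivable in the ordered adjoint sequent calculus (where the cut rule is allowed), then it has a cut-free derivation.
   Context: Ordered adjoint sequent calculus. Fix a preorder $(\mathcal{M},\geq)$ of modes and, for each mode $m$, a set $\sigma(m)\subseteq\{\mathsf{W},\mathsf{C}^\leftarrow,\mathsf{C}^\rightarrow,\mathsf{M}^\leftarrow,\mathsf{M}^\rightarrow\}$ of structural properties (weakening, left/right contraction, left/right mobility), monotone: $k\geq m$ implies $\sigma(k)\supseteq\sigma(m)$. Propositions: $A_m ::= P_m \mid A_m \rightarrowtail B_m \mid A_m \twoheadrightarrow B_m \mid A_m \,\&\, B_m \mid {\uparrow}^m_l A_l\ (m\geq l) \mid A_m\bullet B_m \mid 1_m \mid A_m\oplus B_m \mid {\downarrow}^k_m A_k\ (k\geq m)$, with $P_m$ atomic. An ordered context $\Omega$ is a finite sequence of labeled antecedents $x{:}A_m$; a variable may occur several times, all occurrences labeling the same proposition. $\Omega\geq m$ means every antecedent $y{:}B_k$ of $\Omega$ has $k\geq m$. A sequent $\Omega\vdash C_r$ presupposes $\Omega\geq r$. Newly introduced variables in premises are fresh. Rules (premises $\Rightarrow$ conclusion): (id) $\Rightarrow x{:}A_m\vdash A_m$. (cut) $\Omega_A\vdash A_m$ and $\Omega_L(x{:}A_m)\Omega_R\vdash C_r$ with $\Omega_A\geq m\geq r$ $\Rightarrow \Omega_L\Omega_A\Omega_R\vdash C_r$. ($1R$) $\Rightarrow \cdot\vdash 1_m$. ($1L$) $\Omega_L\Omega_R\vdash C_r \Rightarrow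 \Omega_L(x{:}1_m)\Omega_R\vdash C_r$. ($\bullet R$) $\Omega_1\vdash A_m$, $\Omega_2\vdash B_m\Rightarrow \Omega_1\Omega_2\vdash A_m\bullet B_m$. ($\bullet L$) $\Omega_L(x_1{:}A_m)(x_2{:}B_m)\Omega_R\vdash C_r\Rightarrow\Omega_L(x{:}A_m\bullet B_m)\Omega_R\vdash C_r$. ($\oplus R_i$) $\Omega\vdash A_m$ (resp. $\Omega\vdash B_m$) $\Rightarrow\Omega\vdash A_m\oplus B_m$. ($\oplus L$) $\Omega_L(y{:}A_m)\Omega_R\vdash C_r$ and $\Omega_L(y{:}B_m)\Omega_R\vdash C_r\Rightarrow\Omega_L(x{:}A_m\oplus B_m)\Omega_R\vdash C_r$. (${\downarrow}R$) $\Omega\vdash A_k$ with $\Omega\geq k\Rightarrow\Omega\vdash{\downarrow}^k_mA_k$. (${\downarrow}L$) $\Omega_L(y{:}A_k)\Omega_R\vdash C_r\Rightarrow\Omega_L(x{:}{\downarrow}^k_mA_k)\Omega_R\vdash C_r$. ($\twoheadrightarrow R$) $\Omega(x{:}A_m)\vdash B_m\Rightarrow\Omega\vdash A_m\twoheadrightarrow B_m$. ($\twoheadrightarrow L$) $\Omega_A\vdash A_m$, $\Omega_A\geq m$, $\Omega_L(y{:}B_m)\Omega_R\vdash C_r\Rightarrow\Omega_L(f{:}A_m\twoheadrightarrow B_m)\Omega_A\Omega_R\vdash C_r$. ($\rightarrowtail R$) $(x{:}A_m)\Omega\vdash B_m\Rightarrow\Omega\vdash A_m\rightarrowtail B_m$.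 ($\rightarrowtail L$) $\Omega_A\vdash A_m$, $\Omega_A\geq m$, $\Omega_L(y{:}B_m)\Omega_R\vdash C_r\Rightarrow\Omega_L\Omega_A(f{:}A_m\rightarrowtail B_m)\Omega_R\vdash C_r$. ($\& R$) $\Omega\vdash A_m$, $\Omega\vdash B_m\Rightarrow\Omega\vdash A_m\&B_m$. ($\& L_i$) $\Omega_L(y{:}A_m)\Omega_R\vdash C_r$ (resp. $y{:}B_m$) $\Rightarrow\Omega_L(x{:}A_m\&B_m)\Omega_R\vdash C_r$. (${\uparrow}R$) $\Omega\vdash A_l\Rightarrow\Omega\vdash{\uparrow}^m_lA_l$. (${\uparrow}L$) $\Omega_L(y{:}A_l)\Omega_R\vdash C_r$ with $l\geq r\Rightarrow\Omega_L(x{:}{\uparrow}^m_lA_l)\Omega_R\vdash C_r$. Structural rules: ($\mathsf{M}^\leftarrow$) $\Omega_L\Omega_M(x{:}A_m)\Omega_R\vdash C_r$, $\mathsf{M}^\leftarrow\in\sigma(m)\Rightarrow\Omega_L(x{:}A_m)\Omega_M\Omega_R\vdash C_r$. ($\mathsf{M}^\rightarrow$) $\Omega_L(x{:}A_m)\Omega_M\Omega_R\vdash C_r$, $\mathsf{M}^\rightarrow\in\sigma(m)\Rightarrow\Omega_L\Omega_M(x{:}A_m)\Omega_R\vdash C_r$. ($\mathsf{C}^\leftarrow$) $\Omega_L(x{:}A_m)\Omega_M(x{:}A_m)\Omega_R\vdash C_r$, $\mathsf{C}^\leftarrow\in\sigma(m)\Rightarrow\Omega_L(x{:}A_m)\Omega_M\Omega_R\vdash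 C_r$. ($\mathsf{C}^\rightarrow$) same premise, $\mathsf{C}^\rightarrow\in\sigma(m)\Rightarrow\Omega_L\Omega_M(x{:}A_m)\Omega_R\vdash C_r$. ($\mathsf{W}$) $\Omega_L\Omega_R\vdash C_r$, $\mathsf{W}\in\sigma(m)\Rightarrow\Omega_L(x{:}A_m)\Omega_R\vdash C_r$. A derivation is cut-free if it does not use (cut). *)

theory Defs
  imports Main
begin

datatype structural = Wk | CLeft | CRight | MLeft | MRight

text \<open>
  The mode-indexed grammar is rendered by raw propositions, the mode of a proposition, and a
  well-formedness predicate. Only the outer mode of a shift is stored:
  \<open>Up m A\<close> is the upshift of \<open>A\<close> from its mode l to m, and \<open>Down m A\<close> the downshift of \<open>A\<close>
  from its mode k to m. \<open>LImp A B\<close> is the implication taking its argument on the left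
  (\<open>A \<rightarrowtail> B\<close>) and \<open>RImp A B\<close> the one taking it on the right.
\<close>

datatype ('m, 'p) fm =
    Atom 'm 'p
  | LImp "('m, 'p) fm" "('m, 'p) fm"
  | RImp "('m, 'p) fm" "('m, 'p) fm"
  | With "('m, 'p) fm" "('m, 'p) fm"
  | Up 'm "('m, 'p) fm"
  | Fuse "('m, 'p) fm" "('m, 'p) fm"
  | Unit 'm
  | Oplus "('m, 'p) fm" "('m, 'p) fm"
  | Down 'm "('m, 'p) fm"

primrec mode_of :: "('m, 'p) fm \<Rightarrow> 'm" where
  "mode_of (Atom m p) = m"
| "mode_of (LImp A B) = mode_of A"
| "mode_of (RImp A B) = mode_of A"
| "mode_of (With A B) = mode_of A"
| "mode_of (Up m A) = m"
| "mode_of (Fuse A B) = mode_of A"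
| "mode_of (Unit m) = m"
| "mode_of (Oplus A B) = mode_of A"
| "mode_of (Down m A) = m"

primrec wf_fm :: "('m::preorder, 'p) fm \<Rightarrow> bool" where
  "wf_fm (Atom m p) \<longleftrightarrow> True"
| "wf_fm (LImp A B) \<longleftrightarrow> wf_fm A \<and> wf_fm B \<and> mode_of A = mode_of B"
| "wf_fm (RImp A B) \<longleftrightarrow> wf_fm A \<and> wf_fm B \<and> mode_of A = mode_of B"
| "wf_fm (With A B) \<longleftrightarrow> wf_fm A \<and> wf_fm B \<and> mode_of A = mode_of B"
| "wf_fm (Up m A) \<longleftrightarrow> wf_fm A \<and> m \<ge> mode_of A"
| "wf_fm (Fuse A B) \<longleftrightarrow> wf_fm A \<and> wf_fm B \<and> mode_of A = mode_of B"
| "wf_fm (Unit m) \<longleftrightarrow> True"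
| "wf_fm (Oplus A B) \<longleftrightarrow> wf_fm A \<and> wf_fm B \<and> mode_of A = mode_of B"
| "wf_fm (Down m A) \<longleftrightarrow> wf_fm A \<and> mode_of A \<ge> m"

type_synonym var = nat
type_synonym ('m, 'p) ctx = "(var \<times> ('m, 'p) fm) list"

definition vars :: "('m, 'p) ctx \<Rightarrow> var set" where
  "vars \<Omega> = fst ` set \<Omega>"

definition ctx_ge :: "('m::preorder, 'p) ctx \<Rightarrow> 'm \<Rightarrow> bool" where
  "ctx_ge \<Omega> m \<longleftrightarrow> (\<forall>(y, B) \<in> set \<Omega>. mode_of B \<ge> m)"

definition wf_ctx :: "('m::preorder, 'p) ctx \<Rightarrow> bool" where
  "wf_ctx \<Omega> \<longleftrightarrow> (\<forall>(y, B) \<in> set \<Omega>. wf_fm B) \<and>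
     (\<forall>x A B. (x, A) \<in> set \<Omega> \<longrightarrow> (x, B) \<in> set \<Omega> \<longrightarrow> A = B)"

definition wf_seq :: "('m::preorder, 'p) ctx \<Rightarrow> ('m, 'p) fm \<Rightarrow> bool" where
  "wf_seq \<Omega> C \<longleftrightarrow> wf_ctx \<Omega> \<and> wf_fm C \<and> ctx_ge \<Omega> (mode_of C)"

text \<open>
  The flag \<open>c\<close> says whether (cut) may be used. Every rule except \<open>UnitR\<close>, where it is
  trivial, demands that its conclusion satisfies the presuppositions on sequents, so that all
  sequents of a derivation do. A variable newly introduced in a premise is fresh if it does
  not occur in the conclusion.
\<close>

inductive deriv :: "bool \<Rightarrow> ('m::preorder \<Rightarrow> structural set) \<Rightarrow> ('m, 'p) ctx \<Rightarrow> ('m, 'p) fm \<Rightarrow> bool"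
  for c :: bool and \<sigma> :: "'m::preorder \<Rightarrow> structural set"
where
  id: "wf_seq [(x, A)] A \<Longrightarrow> deriv c \<sigma> [(x, A)] A"
| cut: "\<lbrakk>c; deriv c \<sigma> \<Omega>A A; deriv c \<sigma> (\<Omega>L @ [(x, A)] @ \<Omega>R) C;
     ctx_ge \<Omega>A (mode_of A); mode_of A \<ge> mode_of C; x \<notin> vars (\<Omega>L @ \<Omega>A @ \<Omega>R);
     wf_seq (\<Omega>L @ \<Omega>A @ \<Omega>R) C\<rbrakk>
   \<Longrightarrow> deriv c \<sigma> (\<Omega>L @ \<Omega>A @ \<Omega>R) C"
| UnitR: "deriv c \<sigma> [] (Unit m)"
| UnitL: "\<lbrakk>deriv c \<sigma> (\<Omega>L @ \<Omega>R) C; wf_seq (\<Omega>L @ [(x, Unit m)] @ \<Omega>R) C\<rbrakk>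
   \<Longrightarrow> deriv c \<sigma> (\<Omega>L @ [(x, Unit m)] @ \<Omega>R) C"
| FuseR: "\<lbrakk>deriv c \<sigma> \<Omega>1 A; deriv c \<sigma> \<Omega>2 B; wf_seq (\<Omega>1 @ \<Omega>2) (Fuse A B)\<rbrakk>
   \<Longrightarrow> deriv c \<sigma> (\<Omega>1 @ \<Omega>2) (Fuse A B)"
| FuseL: "\<lbrakk>deriv c \<sigma> (\<Omega>L @ [(x1, A), (x2, B)] @ \<Omega>R) C;
     x1 \<noteq> x2; x1 \<notin> vars (\<Omega>L @ [(x, Fuse A B)] @ \<Omega>R); x2 \<notin> vars (\<Omega>L @ [(x, Fuse A B)] @ \<Omega>R);
     wf_seq (\<Omega>L @ [(x, Fuse A B)] @ \<Omega>R) C\<rbrakk>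
   \<Longrightarrow> deriv c \<sigma> (\<Omega>L @ [(x, Fuse A B)] @ \<Omega>R) C"
| OplusR1: "\<lbrakk>deriv c \<sigma> \<Omega> A; wf_seq \<Omega> (Oplus A B)\<rbrakk> \<Longrightarrow> deriv c \<sigma> \<Omega> (Oplus A B)"
| OplusR2: "\<lbrakk>deriv c \<sigma> \<Omega> B; wf_seq \<Omega> (Oplus A B)\<rbrakk> \<Longrightarrow> deriv c \<sigma> \<Omega> (Oplus A B)"
| OplusL: "\<lbrakk>deriv c \<sigma> (\<Omega>L @ [(y, A)] @ \<Omega>R) C; deriv c \<sigma> (\<Omega>L @ [(y, B)] @ \<Omega>R) C;
     y \<notin> vars (\<Omega>L @ [(x, Oplus A B)] @ \<Omega>R); wf_seq (\<Omega>L @ [(x, Oplus A B)] @ \<Omega>R) C\<rbrakk>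
   \<Longrightarrow> deriv c \<sigma> (\<Omega>L @ [(x, Oplus A B)] @ \<Omega>R) C"
| DownR: "\<lbrakk>deriv c \<sigma> \<Omega> A; ctx_ge \<Omega> (mode_of A); wf_seq \<Omega> (Down m A)\<rbrakk>
   \<Longrightarrow> deriv c \<sigma> \<Omega> (Down m A)"
| DownL: "\<lbrakk>deriv c \<sigma> (\<Omega>L @ [(y, A)] @ \<Omega>R) C;
     y \<notin> vars (\<Omega>L @ [(x, Down m A)] @ \<Omega>R); wf_seq (\<Omega>L @ [(x, Down m A)] @ \<Omega>R) C\<rbrakk>
   \<Longrightarrow> deriv c \<sigma> (\<Omega>L @ [(x, Down m A)] @ \<Omega>R) C"
| RImpR: "\<lbrakk>deriv c \<sigma> (\<Omega> @ [(x, A)]) B; x \<notin> vars \<Omega>; wf_seq \<Omega> (RImp A B)\<rbrakk>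
   \<Longrightarrow> deriv c \<sigma> \<Omega> (RImp A B)"
| RImpL: "\<lbrakk>deriv c \<sigma> \<Omega>A A; ctx_ge \<Omega>A (mode_of A); deriv c \<sigma> (\<Omega>L @ [(y, B)] @ \<Omega>R) C;
     y \<notin> vars (\<Omega>L @ [(f, RImp A B)] @ \<Omega>A @ \<Omega>R);
     wf_seq (\<Omega>L @ [(f, RImp A B)] @ \<Omega>A @ \<Omega>R) C\<rbrakk>
   \<Longrightarrow> deriv c \<sigma> (\<Omega>L @ [(f, RImp A B)] @ \<Omega>A @ \<Omega>R) C"
| LImpR: "\<lbrakk>deriv c \<sigma> ([(x, A)] @ \<Omega>) B; x \<notin> vars \<Omega>; wf_seq \<Omega> (LImp A B)\<rbrakk>
   \<Longrightarrow> deriv c \<sigma> \<Omega> (LImp A B)"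
| LImpL: "\<lbrakk>deriv c \<sigma> \<Omega>A A; ctx_ge \<Omega>A (mode_of A); deriv c \<sigma> (\<Omega>L @ [(y, B)] @ \<Omega>R) C;
     y \<notin> vars (\<Omega>L @ \<Omega>A @ [(f, LImp A B)] @ \<Omega>R);
     wf_seq (\<Omega>L @ \<Omega>A @ [(f, LImp A B)] @ \<Omega>R) C\<rbrakk>
   \<Longrightarrow> deriv c \<sigma> (\<Omega>L @ \<Omega>A @ [(f, LImp A B)] @ \<Omega>R) C"
| WithR: "\<lbrakk>deriv c \<sigma> \<Omega> A; deriv c \<sigma> \<Omega> B; wf_seq \<Omega> (With A B)\<rbrakk>
   \<Longrightarrow> deriv c \<sigma> \<Omega> (With A B)"
| WithL1: "\<lbrakk>deriv c \<sigma> (\<Omega>L @ [(y, A)] @ \<Omega>R) C;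
     y \<notin> vars (\<Omega>L @ [(x, With A B)] @ \<Omega>R); wf_seq (\<Omega>L @ [(x, With A B)] @ \<Omega>R) C\<rbrakk>
   \<Longrightarrow> deriv c \<sigma> (\<Omega>L @ [(x, With A B)] @ \<Omega>R) C"
| WithL2: "\<lbrakk>deriv c \<sigma> (\<Omega>L @ [(y, B)] @ \<Omega>R) C;
     y \<notin> vars (\<Omega>L @ [(x, With A B)] @ \<Omega>R); wf_seq (\<Omega>L @ [(x, With A B)] @ \<Omega>R) C\<rbrakk>
   \<Longrightarrow> deriv c \<sigma> (\<Omega>L @ [(x, With A B)] @ \<Omega>R) C"
| UpR: "\<lbrakk>deriv c \<sigma> \<Omega> A; wf_seq \<Omega> (Up m A)\<rbrakk> \<Longrightarrow> deriv c \<sigma> \<Omega> (Up m A)"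
| UpL: "\<lbrakk>deriv c \<sigma> (\<Omega>L @ [(y, A)] @ \<Omega>R) C; mode_of A \<ge> mode_of C;
     y \<notin> vars (\<Omega>L @ [(x, Up m A)] @ \<Omega>R); wf_seq (\<Omega>L @ [(x, Up m A)] @ \<Omega>R) C\<rbrakk>
   \<Longrightarrow> deriv c \<sigma> (\<Omega>L @ [(x, Up m A)] @ \<Omega>R) C"
| mobility_left: "\<lbrakk>deriv c \<sigma> (\<Omega>L @ \<Omega>M @ [(x, A)] @ \<Omega>R) C; MLeft \<in> \<sigma> (mode_of A);
     wf_seq (\<Omega>L @ [(x, A)] @ \<Omega>M @ \<Omega>R) C\<rbrakk>
   \<Longrightarrow> deriv c \<sigma> (\<Omega>L @ [(x, A)] @ \<Omega>M @ \<Omega>R) C"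
| mobility_right: "\<lbrakk>deriv c \<sigma> (\<Omega>L @ [(x, A)] @ \<Omega>M @ \<Omega>R) C; MRight \<in> \<sigma> (mode_of A);
     wf_seq (\<Omega>L @ \<Omega>M @ [(x, A)] @ \<Omega>R) C\<rbrakk>
   \<Longrightarrow> deriv c \<sigma> (\<Omega>L @ \<Omega>M @ [(x, A)] @ \<Omega>R) C"
| contraction_left: "\<lbrakk>deriv c \<sigma> (\<Omega>L @ [(x, A)] @ \<Omega>M @ [(x, A)] @ \<Omega>R) C; CLeft \<in> \<sigma> (mode_of A);
     wf_seq (\<Omega>L @ [(x, A)] @ \<Omega>M @ \<Omega>R) C\<rbrakk>
   \<Longrightarrow> deriv c \<sigma> (\<Omega>L @ [(x, A)] @ \<Omega>M @ \<Omega>R) C"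
| contraction_right: "\<lbrakk>deriv c \<sigma> (\<Omega>L @ [(x, A)] @ \<Omega>M @ [(x, A)] @ \<Omega>R) C; CRight \<in> \<sigma> (mode_of A);
     wf_seq (\<Omega>L @ \<Omega>M @ [(x, A)] @ \<Omega>R) C\<rbrakk>
   \<Longrightarrow> deriv c \<sigma> (\<Omega>L @ \<Omega>M @ [(x, A)] @ \<Omega>R) C"
| weakening: "\<lbrakk>deriv c \<sigma> (\<Omega>L @ \<Omega>R) C; Wk \<in> \<sigma> (mode_of A); wf_seq (\<Omega>L @ [(x, A)] @ \<Omega>R) C\<rbrakk>
   \<Longrightarrow> deriv c \<sigma> (\<Omega>L @ [(x, A)] @ \<Omega>R) C"

abbreviation derivable where "derivable \<equiv> deriv True"
abbreviation cut_free_derivable where "cut_free_derivable \<equiv> deriv False"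

end

theory Submission
  imports Defs
begin

text \<open>
  Variable names carry no information beyond the consistency of the labelling: erasing them
  yields a calculus on lists of propositions, and any consistent naming of the endsequent of an
  erased derivation lifts to the derivation, both copies of a contracted antecedent receiving the
  same name. Cut elimination is then done without names, by a multicut: given
  \<open>\<Delta> \<turnstile> A\<close>, replace any selection of occurrences of \<open>A\<close> in a context by \<open>\<Delta>\<close>, by
  induction on the derivation from that context. Structural rules on selected occurrences become
  structural rules on the block \<open>\<Delta>\<close>, which are available because \<open>\<sigma>\<close> is monotone.
  The derivation of \<open>\<Delta> \<turnstile> A\<close> is analysed only when a logical left rule acts on a selected
  occurrence; at that point all other selected occurrences have already been replaced, so its left
  rules permute downwards with a single copy, and its right rules give cuts on subformulas.
\<close>

section \<open>The calculus without names\<close>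

text \<open>This is what remains of the presuppositions on a sequent once names are erased;
  consistency of the labelling is kept apart in \<open>wf_ctx\<close>.\<close>

definition wf_nameless :: "('m::preorder, 'p) fm list \<Rightarrow> ('m, 'p) fm \<Rightarrow> bool" where
  "wf_nameless \<Gamma> C \<longleftrightarrow> wf_fm C \<and> (\<forall>B \<in> set \<Gamma>. wf_fm B \<and> mode_of C \<le> mode_of B)"

text \<open>Rules are data, with the set of premises as first argument, so that inductions on
  derivations have only three cases and arguments uniform in the rule are given once.\<close>

inductive right_rule ::
  "(('m, 'p) fm list \<times> ('m, 'p) fm) set \<Rightarrow> ('m, 'p) fm list \<Rightarrow> ('m, 'p) fm \<Rightarrow> bool" where
  Unit: "right_rule {} [] (Unit m)"
| Fuse: "right_rule {(\<Gamma>1, A), (\<Gamma>2, B)} (\<Gamma>1 @ \<Gamma>2) (Fuse A B)"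
| Oplus1: "right_rule {(\<Gamma>, A)} \<Gamma> (Oplus A B)"
| Oplus2: "right_rule {(\<Gamma>, B)} \<Gamma> (Oplus A B)"
| Down: "right_rule {(\<Gamma>, A)} \<Gamma> (Down m A)"
| RImp: "right_rule {(\<Gamma> @ [A], B)} \<Gamma> (RImp A B)"
| LImp: "right_rule {([A] @ \<Gamma>, B)} \<Gamma> (LImp A B)"
| With: "right_rule {(\<Gamma>, A), (\<Gamma>, B)} \<Gamma> (With A B)"
| Up: "right_rule {(\<Gamma>, A)} \<Gamma> (Up m A)"

text \<open>
  In \<open>left_rule \<sigma> S \<Phi> T\<close> the segment \<open>\<Phi>\<close> of the conclusion is replaced by each member of
  \<open>T\<close> in the premises that keep the succedent; \<open>S\<close> collects the remaining premises.
\<close>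

inductive left_rule :: "('m \<Rightarrow> structural set) \<Rightarrow>
  (('m, 'p) fm list \<times> ('m, 'p) fm) set \<Rightarrow> ('m, 'p) fm list \<Rightarrow> ('m, 'p) fm list set \<Rightarrow> bool"
  for \<sigma> where
  Unit: "left_rule \<sigma> {} [Unit m] {[]}"
| Fuse: "left_rule \<sigma> {} [Fuse A B] {[A, B]}"
| Oplus: "left_rule \<sigma> {} [Oplus A B] {[A], [B]}"
| Down: "left_rule \<sigma> {} [Down m A] {[A]}"
| With1: "left_rule \<sigma> {} [With A B] {[A]}"
| With2: "left_rule \<sigma> {} [With A B] {[B]}"
| Up: "left_rule \<sigma> {} [Up m A] {[A]}"
| RImp: "left_rule \<sigma> {(\<Gamma>, A)} ([RImp A B] @ \<Gamma>) {[B]}"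
| LImp: "left_rule \<sigma> {(\<Gamma>, A)} (\<Gamma> @ [LImp A B]) {[B]}"
| mobility_left: "MLeft \<in> \<sigma> (mode_of A) \<Longrightarrow> left_rule \<sigma> {} ([A] @ \<Gamma>) {\<Gamma> @ [A]}"
| mobility_right: "MRight \<in> \<sigma> (mode_of A) \<Longrightarrow> left_rule \<sigma> {} (\<Gamma> @ [A]) {[A] @ \<Gamma>}"
| contraction_left:
    "CLeft \<in> \<sigma> (mode_of A) \<Longrightarrow> left_rule \<sigma> {} ([A] @ \<Gamma>) {[A] @ \<Gamma> @ [A]}"
| contraction_right:
    "CRight \<in> \<sigma> (mode_of A) \<Longrightarrow> left_rule \<sigma> {} (\<Gamma> @ [A]) {[A] @ \<Gamma> @ [A]}"
| weakening: "Wk \<in> \<sigma> (mode_of A) \<Longrightarrow> left_rule \<sigma> {} [A] {[]}"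

text \<open>The mode conditions of \<open>DownR\<close>, \<open>UpL\<close>, \<open>RImpL\<close>
  and \<open>LImpL\<close> are implicit here: each of them is part of the well-formedness of a
  premise, which every derivable sequent has.\<close>

inductive nameless ::
  "('m::preorder \<Rightarrow> structural set) \<Rightarrow> ('m, 'p) fm list \<Rightarrow> ('m, 'p) fm \<Rightarrow> bool"
  for \<sigma> where
  id: "wf_fm A \<Longrightarrow> nameless \<sigma> [A] A"
| right: "\<lbrakk>right_rule S \<Gamma> C; \<And>\<Theta> B. (\<Theta>, B) \<in> S \<Longrightarrow> nameless \<sigma> \<Theta> B; wf_nameless \<Gamma> C\<rbrakk>
    \<Longrightarrow> nameless \<sigma> \<Gamma> C"
| left: "\<lbrakk>left_rule \<sigma> S \<Phi> T; \<And>\<Theta> B. (\<Theta>, B) \<in> S \<Longrightarrow> nameless \<sigma> \<Theta> B;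
     \<And>\<Theta>. \<Theta> \<in> T \<Longrightarrow> nameless \<sigma> (\<Gamma>L @ \<Theta> @ \<Gamma>R) C; wf_nameless (\<Gamma>L @ \<Phi> @ \<Gamma>R) C\<rbrakk>
    \<Longrightarrow> nameless \<sigma> (\<Gamma>L @ \<Phi> @ \<Gamma>R) C"

lemma nameless_wf: "nameless \<sigma> \<Gamma> C \<Longrightarrow> wf_nameless \<Gamma> C"
  by (erule nameless.cases) (auto simp: wf_nameless_def)

text \<open>Antecedents of \<Delta> lie above the mode of \<open>A\<close>, which lies above the
  mode of \<open>C\<close>; transitivity yields the presupposition for the result of a cut.\<close>

lemma wf_nameless_cut:
  "wf_nameless \<Delta> A \<Longrightarrow> wf_nameless (\<Gamma>L @ [A] @ \<Gamma>R) C \<Longrightarrow> wf_nameless (\<Gamma>L @ \<Delta> @ \<Gamma>R) C"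
  unfolding wf_nameless_def by (auto intro: order_trans)

lemma nameless_left1:
  assumes "left_rule \<sigma> {} \<Phi> {\<Theta>}" "nameless \<sigma> (\<Gamma>L @ \<Theta> @ \<Gamma>R) C" "wf_nameless (\<Gamma>L @ \<Phi> @ \<Gamma>R) C"
  shows "nameless \<sigma> (\<Gamma>L @ \<Phi> @ \<Gamma>R) C"
  by (rule nameless.left[OF assms(1)]) (use assms(2,3) in auto)

section \<open>Structural rules for whole blocks of antecedents\<close>

lemma block_mobility_left:
  assumes "nameless \<sigma> (\<Gamma>L @ \<Gamma> @ \<Delta> @ \<Gamma>R) C" "\<forall>B \<in> set \<Delta>. MLeft \<in> \<sigma> (mode_of B)"
  shows "nameless \<sigma> (\<Gamma>L @ \<Delta> @ \<Gamma> @ \<Gamma>R) C"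
  using assms
proof (induction \<Delta> arbitrary: \<Gamma>L)
  case (Cons A \<Delta>)
  have "wf_nameless (\<Gamma>L @ ([A] @ \<Gamma>) @ \<Delta> @ \<Gamma>R) C"
    using nameless_wf[OF Cons.prems(1)] by (auto simp: wf_nameless_def)
  then have "nameless \<sigma> (\<Gamma>L @ ([A] @ \<Gamma>) @ \<Delta> @ \<Gamma>R) C"
    using nameless_left1[OF left_rule.mobility_left, of \<sigma> A \<Gamma>L \<Gamma> "\<Delta> @ \<Gamma>R" C] Cons.prems by simp
  then show ?case
    using Cons.IH[of "\<Gamma>L @ [A]"] Cons.prems(2) by simp
qed simp

text \<open>Here the last antecedent of the block has to move first, whereas leftward moves start
  with the first one; either way the order within the block is preserved.\<close>

lemma block_mobility_right:
  assumes "nameless \<sigma> (\<Gamma>L @ \<Delta> @ \<Gamma> @ \<Gamma>R) C" "\<forall>B \<in> set \<Delta>. MRight \<in> \<sigma> (mode_of B)"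
  shows "nameless \<sigma> (\<Gamma>L @ \<Gamma> @ \<Delta> @ \<Gamma>R) C"
  using assms
proof (induction \<Delta> arbitrary: \<Gamma>R rule: rev_induct)
  case (snoc A \<Delta>)
  have "wf_nameless ((\<Gamma>L @ \<Delta>) @ (\<Gamma> @ [A]) @ \<Gamma>R) C"
    using nameless_wf[OF snoc.prems(1)] by (auto simp: wf_nameless_def)
  then have "nameless \<sigma> ((\<Gamma>L @ \<Delta>) @ (\<Gamma> @ [A]) @ \<Gamma>R) C"
    using nameless_left1[OF left_rule.mobility_right, of \<sigma> A "\<Gamma>L @ \<Delta>" \<Gamma> \<Gamma>R C] snoc.prems by simp
  then show ?case
    using snoc.IH[of "[A] @ \<Gamma>R"] snoc.prems(2) by simp
qed simp

text \<open>The two copies of the first antecedent of the block are contracted across the rest of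
  the left block together with \<Gamma>; the survivor then joins the left context.\<close>

lemma block_contraction_left:
  assumes "nameless \<sigma> (\<Gamma>L @ \<Delta> @ \<Gamma> @ \<Delta> @ \<Gamma>R) C" "\<forall>B \<in> set \<Delta>. CLeft \<in> \<sigma> (mode_of B)"
  shows "nameless \<sigma> (\<Gamma>L @ \<Delta> @ \<Gamma> @ \<Gamma>R) C"
  using assms
proof (induction \<Delta> arbitrary: \<Gamma>L)
  case (Cons A \<Delta>)
  have "wf_nameless (\<Gamma>L @ ([A] @ \<Delta> @ \<Gamma>) @ \<Delta> @ \<Gamma>R) C"
    using nameless_wf[OF Cons.prems(1)] by (auto simp: wf_nameless_def)
  then have "nameless \<sigma> (\<Gamma>L @ ([A] @ \<Delta> @ \<Gamma>) @ \<Delta> @ \<Gamma>R) C"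
    using nameless_left1[OF left_rule.contraction_left, of \<sigma> A \<Gamma>L "\<Delta> @ \<Gamma>" "\<Delta> @ \<Gamma>R" C] Cons.prems
    by simp
  then show ?case
    using Cons.IH[of "\<Gamma>L @ [A]"] Cons.prems(2) by simp
qed simp

text \<open>As for left contraction, except that the survivor sits just before the rest of the right
  block, so it is absorbed into the middle segment and \<Gamma> must be general in the
  induction.\<close>

lemma block_contraction_right:
  assumes "nameless \<sigma> (\<Gamma>L @ \<Delta> @ \<Gamma> @ \<Delta> @ \<Gamma>R) C" "\<forall>B \<in> set \<Delta>. CRight \<in> \<sigma> (mode_of B)"
  shows "nameless \<sigma> (\<Gamma>L @ \<Gamma> @ \<Delta> @ \<Gamma>R) C"
  using assms
proof (induction \<Delta> arbitrary: \<Gamma>)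
  case (Cons A \<Delta>)
  have "wf_nameless (\<Gamma>L @ ((\<Delta> @ \<Gamma>) @ [A]) @ \<Delta> @ \<Gamma>R) C"
    using nameless_wf[OF Cons.prems(1)] by (auto simp: wf_nameless_def)
  then have "nameless \<sigma> (\<Gamma>L @ ((\<Delta> @ \<Gamma>) @ [A]) @ \<Delta> @ \<Gamma>R) C"
    using nameless_left1[OF left_rule.contraction_right, of \<sigma> A \<Gamma>L "\<Delta> @ \<Gamma>" "\<Delta> @ \<Gamma>R" C] Cons.prems
    by simp
  then show ?case
    using Cons.IH[of "\<Gamma> @ [A]"] Cons.prems(2) by simp
qed simp

lemma block_weakening:
  assumes "nameless \<sigma> (\<Gamma>L @ \<Gamma>R) C" "\<forall>B \<in> set \<Delta>. Wk \<in> \<sigma> (mode_of B)"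
    and "wf_nameless (\<Gamma>L @ \<Delta> @ \<Gamma>R) C"
  shows "nameless \<sigma> (\<Gamma>L @ \<Delta> @ \<Gamma>R) C"
  using assms
proof (induction \<Delta>)
  case (Cons A \<Delta>)
  have "wf_nameless (\<Gamma>L @ \<Delta> @ \<Gamma>R) C"
    using Cons.prems(3) by (auto simp: wf_nameless_def)
  then have "nameless \<sigma> (\<Gamma>L @ [] @ \<Delta> @ \<Gamma>R) C"
    using Cons by simp
  then have "nameless \<sigma> (\<Gamma>L @ [A] @ \<Delta> @ \<Gamma>R) C"
    using nameless_left1[OF left_rule.weakening, of \<sigma> A \<Gamma>L "\<Delta> @ \<Gamma>R" C] Cons.prems(2,3) by simp
  then show ?case by simp
qed simp

section \<open>Cut elimination\<close>

text \<open>A relation rather than a function, because each occurrence of \<open>a\<close> may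
  independently be kept or replaced. Selecting none, one or several occurrences are all
  instances.\<close>

primrec replaces :: "'a \<Rightarrow> 'a list \<Rightarrow> 'a list \<Rightarrow> 'a list \<Rightarrow> bool" where
  "replaces a \<Delta> [] zs \<longleftrightarrow> zs = []"
| "replaces a \<Delta> (b # xs) zs \<longleftrightarrow>
     (\<exists>us vs. zs = us @ vs \<and> (us = [b] \<or> b = a \<and> us = \<Delta>) \<and> replaces a \<Delta> xs vs)"

lemma replaces_append:
  "replaces a \<Delta> (xs @ ys) zs \<longleftrightarrow>
     (\<exists>us vs. zs = us @ vs \<and> replaces a \<Delta> xs us \<and> replaces a \<Delta> ys vs)"
proof (induction xs arbitrary: zs)
  case (Cons b xs)
  show ?case
  proof
    assume "replaces a \<Delta> ((b # xs) @ ys) zs"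
    then obtain us vs ws where "zs = us @ vs @ ws" "us = [b] \<or> b = a \<and> us = \<Delta>"
      "replaces a \<Delta> xs vs" "replaces a \<Delta> ys ws"
      unfolding append_Cons replaces.simps Cons by blast
    then show "\<exists>us vs. zs = us @ vs \<and> replaces a \<Delta> (b # xs) us \<and> replaces a \<Delta> ys vs"
      by (intro exI[of _ "us @ vs"] exI[of _ ws]) auto
  next
    assume "\<exists>us vs. zs = us @ vs \<and> replaces a \<Delta> (b # xs) us \<and> replaces a \<Delta> ys vs"
    then obtain us vs ws where "zs = (us @ vs) @ ws" "us = [b] \<or> b = a \<and> us = \<Delta>"
      "replaces a \<Delta> xs vs" "replaces a \<Delta> ys ws"
      unfolding replaces.simps by blast
    then show "replaces a \<Delta> ((b # xs) @ ys) zs"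
      using Cons by auto
  qed
qed simp

lemma replaces_single: "replaces a \<Delta> [b] zs \<longleftrightarrow> zs = [b] \<or> b = a \<and> zs = \<Delta>"
  by auto

lemma replaces_refl: "replaces a \<Delta> xs xs"
proof (induction xs)
  case (Cons b xs)
  then show ?case
    unfolding replaces.simps by (intro exI[of _ "[b]"] exI[of _ xs]) simp
qed simp

lemma replaces_appendI:
  "replaces a \<Delta> xs us \<Longrightarrow> replaces a \<Delta> ys vs \<Longrightarrow> replaces a \<Delta> (xs @ ys) (us @ vs)"
  by (auto simp: replaces_append)

lemma replaces_set: "replaces a \<Delta> xs zs \<Longrightarrow> b \<in> set zs \<Longrightarrow> b \<in> set xs \<or> a \<in> set xs \<and> b \<in> set \<Delta>"
  by (induction xs arbitrary: zs) fastforce+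

lemma wf_nameless_replaces:
  assumes "replaces A \<Delta> \<Gamma> \<Gamma>'" "wf_nameless \<Delta> A" "wf_nameless \<Gamma> C"
  shows "wf_nameless \<Gamma>' C"
  using replaces_set[OF assms(1)] assms(2,3) unfolding wf_nameless_def
  by (blast intro: order_trans)

text \<open>Right rules inspect no antecedent, so the same rule applies after replacement, with the
  selection distributed over its premises.\<close>

lemma right_rule_replaces:
  assumes "right_rule S \<Gamma> C" "replaces A \<Delta> \<Gamma> \<Gamma>'"
  obtains S' where "right_rule S' \<Gamma>' C"
    "\<And>\<Theta>' B. (\<Theta>', B) \<in> S' \<Longrightarrow> \<exists>\<Theta>. (\<Theta>, B) \<in> S \<and> replaces A \<Delta> \<Theta> \<Theta>'"
  using assms
proof cases
  case (Fuse \<Gamma>1 A1 \<Gamma>2 A2)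
  then obtain \<Gamma>1' \<Gamma>2' where "\<Gamma>' = \<Gamma>1' @ \<Gamma>2'" "replaces A \<Delta> \<Gamma>1 \<Gamma>1'" "replaces A \<Delta> \<Gamma>2 \<Gamma>2'"
    using assms(2) by (auto simp: replaces_append)
  then show thesis
    using Fuse by (intro that[of "{(\<Gamma>1', A1), (\<Gamma>2', A2)}"]) (auto intro: right_rule.intros)
next
  \<comment> \<open>The discharged antecedent is kept in the premise even if it happens to equal
    \<open>A\<close>; \<open>replaces_refl\<close> expresses this choice.\<close>
  case (RImp A1 A2)
  then show thesis
    using assms(2) replaces_appendI[OF assms(2) replaces_refl]
    by (intro that[of "{(\<Gamma>' @ [A1], A2)}"]) (auto intro: right_rule.intros)
next
  case (LImp A1 A2)
  then show thesis
    using assms(2) replaces_appendI[OF replaces_refl assms(2)]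
    by (intro that[of "{([A1] @ \<Gamma>', A2)}"]) (blast intro: right_rule.intros, blast)
next
  case (Unit m)
  then show thesis
    using assms(2) by (intro that[of "{}"]) (auto intro: right_rule.intros)
next
  case (Oplus1 A1 A2)
  then show thesis
    using assms(2) by (intro that[of "{(\<Gamma>', A1)}"]) (auto intro: right_rule.intros)
next
  case (Oplus2 A2 A1)
  then show thesis
    using assms(2) by (intro that[of "{(\<Gamma>', A2)}"]) (auto intro: right_rule.intros)
next
  case (Down A1 m)
  then show thesis
    using assms(2) by (intro that[of "{(\<Gamma>', A1)}"]) (auto intro: right_rule.intros)
next
  case (With A1 A2)
  then show thesis
    using assms(2) by (intro that[of "{(\<Gamma>', A1), (\<Gamma>', A2)}"]) (auto intro: right_rule.intros)
next
  case (Up A1 m)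
  then show thesis
    using assms(2) by (intro that[of "{(\<Gamma>', A1)}"]) (auto intro: right_rule.intros)
qed

text \<open>Left rules of the derivation of \<open>\<Delta> \<turnstile> A\<close> permute below the cut.\<close>

lemma cut_at_right_rule:
  assumes "nameless \<sigma> \<Delta> A" and "nameless \<sigma> (\<Gamma>L @ [A] @ \<Gamma>R) C"
    and "\<And>S \<Gamma>. \<lbrakk>right_rule S \<Gamma> A; \<And>\<Theta> B. (\<Theta>, B) \<in> S \<Longrightarrow> nameless \<sigma> \<Theta> B;
      wf_nameless (\<Gamma>L @ \<Gamma> @ \<Gamma>R) C\<rbrakk> \<Longrightarrow> nameless \<sigma> (\<Gamma>L @ \<Gamma> @ \<Gamma>R) C"
  shows "nameless \<sigma> (\<Gamma>L @ \<Delta> @ \<Gamma>R) C"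
  using assms
proof (induction rule: nameless.induct)
  case (right S \<Gamma> D)
  then show ?case
    using wf_nameless_cut[OF right.hyps(3) nameless_wf[OF right.prems(1)]] by blast
next
  case (left S \<Phi> T \<Delta>L \<Delta>R D)
  \<comment> \<open>The cut moves into the premises from \<open>T\<close>, which still prove
    \<open>A\<close>; the side premises from \<open>S\<close> are reused as they are.\<close>
  have "nameless \<sigma> ((\<Gamma>L @ \<Delta>L) @ \<Phi> @ \<Delta>R @ \<Gamma>R) C"
  proof (rule nameless.left[OF left.hyps(1,2)])
    show "nameless \<sigma> ((\<Gamma>L @ \<Delta>L) @ \<Theta> @ \<Delta>R @ \<Gamma>R) C" if "\<Theta> \<in> T" for \<Theta>
      using left.IH(2)[OF that] left.prems by simp
    show "wf_nameless ((\<Gamma>L @ \<Delta>L) @ \<Phi> @ \<Delta>R @ \<Gamma>R) C"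
      using wf_nameless_cut[OF left.hyps(4) nameless_wf[OF left.prems(1)]] by simp
  qed
  then show ?case by simp
qed simp

section \<open>Principal reductions and admissibility of cut\<close>

definition cut_admissible :: "('m::preorder \<Rightarrow> structural set) \<Rightarrow> ('m, 'p) fm \<Rightarrow> bool" where
  "cut_admissible \<sigma> A \<longleftrightarrow> (\<forall>\<Delta> \<Gamma>L \<Gamma>R C. nameless \<sigma> \<Delta> A \<longrightarrow>
     nameless \<sigma> (\<Gamma>L @ [A] @ \<Gamma>R) C \<longrightarrow> nameless \<sigma> (\<Gamma>L @ \<Delta> @ \<Gamma>R) C)"

lemma cut_admissibleD:
  "\<lbrakk>cut_admissible \<sigma> A; nameless \<sigma> \<Delta> A; nameless \<sigma> (\<Gamma>L @ [A] @ \<Gamma>R) C\<rbrakk>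
    \<Longrightarrow> nameless \<sigma> (\<Gamma>L @ \<Delta> @ \<Gamma>R) C"
  unfolding cut_admissible_def by blast

inductive_cases right_UnitE: "right_rule S \<Gamma> (Unit m)"
inductive_cases right_FuseE: "right_rule S \<Gamma> (Fuse A B)"
inductive_cases right_OplusE: "right_rule S \<Gamma> (Oplus A B)"
inductive_cases right_DownE: "right_rule S \<Gamma> (Down m A)"
inductive_cases right_WithE: "right_rule S \<Gamma> (With A B)"
inductive_cases right_UpE: "right_rule S \<Gamma> (Up m A)"
inductive_cases right_RImpE: "right_rule S \<Gamma> (RImp A B)"
inductive_cases right_LImpE: "right_rule S \<Gamma> (LImp A B)"

text \<open>The left-rule step of the multicut induction. \<open>minor\<close> and
  \<open>major\<close> are its induction hypotheses, with \<Gamma>L and \<Gamma>R standing for the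
  outer context after replacement; \<open>sub\<close> is the hypothesis on smaller cut
  formulas.\<close>

lemma multicut_left:
  fixes \<sigma> :: "'m::preorder \<Rightarrow> structural set" and A :: "('m, 'p) fm"
  assumes mono: "\<And>k m. k \<ge> m \<Longrightarrow> \<sigma> k \<supseteq> \<sigma> m"
    and sub: "\<And>B :: ('m, 'p) fm. size B < size A \<Longrightarrow> cut_admissible \<sigma> B"
    and \<Delta>: "nameless \<sigma> \<Delta> A"
    and rule: "left_rule \<sigma> S \<Phi> T"
    and minor: "\<And>\<Theta> B \<Theta>'. (\<Theta>, B) \<in> S \<Longrightarrow> replaces A \<Delta> \<Theta> \<Theta>' \<Longrightarrow> nameless \<sigma> \<Theta>' B"
    and major: "\<And>\<Theta> \<Theta>'. \<Theta> \<in> T \<Longrightarrow> replaces A \<Delta> \<Theta> \<Theta>' \<Longrightarrow> nameless \<sigma> (\<Gamma>L @ \<Theta>' @ \<Gamma>R) C"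
    and \<Phi>': "replaces A \<Delta> \<Phi> \<Phi>'"
    and wf: "wf_nameless (\<Gamma>L @ \<Phi>' @ \<Gamma>R) C" "wf_nameless (\<Gamma>L @ \<Phi> @ \<Gamma>R) C"
  shows "nameless \<sigma> (\<Gamma>L @ \<Phi>' @ \<Gamma>R) C"
proof -
  \<comment> \<open>Monotonicity enters here: the antecedents of \<Delta> lie above the mode of
    \<open>A\<close>, so they inherit its structural properties.\<close>
  have \<sigma>_\<Delta>: "\<forall>B \<in> set \<Delta>. s \<in> \<sigma> (mode_of B)" if "s \<in> \<sigma> (mode_of A)" for s
    using that mono nameless_wf[OF \<Delta>] unfolding wf_nameless_def by blast
  have minor_refl: "nameless \<sigma> \<Theta> B" if "(\<Theta>, B) \<in> S" for \<Theta> B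
    by (rule minor[OF that replaces_refl])
  have major_refl: "nameless \<sigma> (\<Gamma>L @ \<Theta> @ \<Gamma>R) C" if "\<Theta> \<in> T" for \<Theta>
    by (rule major[OF that replaces_refl])
  have cut_sub: "nameless \<sigma> (\<Gamma>L @ \<Gamma> @ \<Gamma>R) C"
    if "nameless \<sigma> \<Gamma> B" "[B] \<in> T" "size B < size A" for \<Gamma> B
    using cut_admissibleD[OF sub that(1)] major_refl that by blast
  have keep: "nameless \<sigma> (\<Gamma>L @ \<Phi> @ \<Gamma>R) C"
    using rule minor_refl major_refl wf(2) by (rule nameless.left)
  \<comment> \<open>Shared scheme for rules whose segment is one proposition. If it is unselected,
    \<open>keep\<close> suffices. Otherwise \<open>keep\<close> gives a sequent with one occurrence
    left to cut, and only right rules concluding \<open>A\<close> remain, which \<open>red\<close>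
    has to treat.\<close>
  have principal: ?thesis
    if \<Phi>: "\<Phi> = [B]"
      and red: "\<And>S' \<Gamma>. \<lbrakk>B = A; right_rule S' \<Gamma> A; \<And>\<Theta> D. (\<Theta>, D) \<in> S' \<Longrightarrow> nameless \<sigma> \<Theta> D;
        wf_nameless (\<Gamma>L @ \<Gamma> @ \<Gamma>R) C\<rbrakk> \<Longrightarrow> nameless \<sigma> (\<Gamma>L @ \<Gamma> @ \<Gamma>R) C" for B
  proof -
    consider "\<Phi>' = [B]" | "B = A" "\<Phi>' = \<Delta>"
      using \<Phi>' \<Phi> by (auto simp: replaces_single)
    then show ?thesis
    proof cases
      case 1
      then show ?thesis using keep \<Phi> by simp
    next
      case 2
      show ?thesis
        unfolding 2(2)
      proof (rule cut_at_right_rule[OF \<Delta>])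
        show "nameless \<sigma> (\<Gamma>L @ [A] @ \<Gamma>R) C"
          using keep \<Phi> 2(1) by simp
      qed (use red 2(1) in blast)
    qed
  qed
  from rule show ?thesis
  proof cases
    \<comment> \<open>A right rule for \<open>Unit m\<close> has an empty context, so the sequent
      wanted is already the premise of the left rule.\<close>
    case (Unit m)
    then show ?thesis
      using major_refl by (intro principal) (auto elim: right_UnitE)
  next
    case (Fuse B1 B2)
    show ?thesis
    proof (rule principal[OF Fuse(2)])
      fix S' \<Gamma>
      assume *: "Fuse B1 B2 = A" "right_rule S' \<Gamma> A" "\<And>\<Theta> D. (\<Theta>, D) \<in> S' \<Longrightarrow> nameless \<sigma> \<Theta> D"
      then obtain \<Gamma>1 \<Gamma>2 where \<Gamma>: "\<Gamma> = \<Gamma>1 @ \<Gamma>2" "nameless \<sigma> \<Gamma>1 B1" "nameless \<sigma> \<Gamma>2 B2"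
        by (auto elim!: right_FuseE)
      \<comment> \<open>Two successive cuts on the components; the first leaves \<open>B2\<close> in
        place for the second.\<close>
      have "nameless \<sigma> (\<Gamma>L @ \<Gamma>1 @ [B2] @ \<Gamma>R) C"
        using cut_admissibleD[OF sub \<Gamma>(2), of \<Gamma>L "[B2] @ \<Gamma>R" C] major_refl Fuse(3) *(1) by auto
      then show "nameless \<sigma> (\<Gamma>L @ \<Gamma> @ \<Gamma>R) C"
        using cut_admissibleD[OF sub \<Gamma>(3), of "\<Gamma>L @ \<Gamma>1" \<Gamma>R C] \<Gamma>(1) *(1) by auto
    qed
  next
    case (Oplus B1 B2)
    show ?thesis
    proof (rule principal[OF Oplus(2)])
      fix S' \<Gamma>
      assume *: "Oplus B1 B2 = A" "right_rule S' \<Gamma> A" "\<And>\<Theta> D. (\<Theta>, D) \<in> S' \<Longrightarrow> nameless \<sigma> \<Theta> D"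
      then have "nameless \<sigma> \<Gamma> B1 \<or> nameless \<sigma> \<Gamma> B2"
        by (auto elim!: right_OplusE)
      then show "nameless \<sigma> (\<Gamma>L @ \<Gamma> @ \<Gamma>R) C"
        using cut_sub[of \<Gamma> B1] cut_sub[of \<Gamma> B2] Oplus(3) *(1) by auto
    qed
  next
    case (Down m B)
    show ?thesis
    proof (rule principal[OF Down(2)])
      fix S' \<Gamma>
      assume *: "Down m B = A" "right_rule S' \<Gamma> A" "\<And>\<Theta> D. (\<Theta>, D) \<in> S' \<Longrightarrow> nameless \<sigma> \<Theta> D"
      then have "nameless \<sigma> \<Gamma> B"
        by (auto elim!: right_DownE)
      then show "nameless \<sigma> (\<Gamma>L @ \<Gamma> @ \<Gamma>R) C"
        using cut_sub[of \<Gamma> B] Down(3) *(1) by auto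
    qed
  next
    case (With1 B1 B2)
    show ?thesis
    proof (rule principal[OF With1(2)])
      fix S' \<Gamma>
      assume *: "With B1 B2 = A" "right_rule S' \<Gamma> A" "\<And>\<Theta> D. (\<Theta>, D) \<in> S' \<Longrightarrow> nameless \<sigma> \<Theta> D"
      then have "nameless \<sigma> \<Gamma> B1"
        by (auto elim!: right_WithE)
      then show "nameless \<sigma> (\<Gamma>L @ \<Gamma> @ \<Gamma>R) C"
        using cut_sub[of \<Gamma> B1] With1(3) *(1) by auto
    qed
  next
    case (With2 B1 B2)
    show ?thesis
    proof (rule principal[OF With2(2)])
      fix S' \<Gamma>
      assume *: "With B1 B2 = A" "right_rule S' \<Gamma> A" "\<And>\<Theta> D. (\<Theta>, D) \<in> S' \<Longrightarrow> nameless \<sigma> \<Theta> D"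
      then have "nameless \<sigma> \<Gamma> B2"
        by (auto elim!: right_WithE)
      then show "nameless \<sigma> (\<Gamma>L @ \<Gamma> @ \<Gamma>R) C"
        using cut_sub[of \<Gamma> B2] With2(3) *(1) by auto
    qed
  next
    case (Up m B)
    show ?thesis
    proof (rule principal[OF Up(2)])
      fix S' \<Gamma>
      assume *: "Up m B = A" "right_rule S' \<Gamma> A" "\<And>\<Theta> D. (\<Theta>, D) \<in> S' \<Longrightarrow> nameless \<sigma> \<Theta> D"
      then have "nameless \<sigma> \<Gamma> B"
        by (auto elim!: right_UpE)
      then show "nameless \<sigma> (\<Gamma>L @ \<Gamma> @ \<Gamma>R) C"
        using cut_sub[of \<Gamma> B] Up(3) *(1) by auto
    qed
  next
    case (RImp \<Gamma> B1 B2)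
    then obtain \<Psi> \<Gamma>' where \<Phi>'_eq: "\<Phi>' = \<Psi> @ \<Gamma>'" and \<Psi>: "\<Psi> = [RImp B1 B2] \<or> RImp B1 B2 = A \<and> \<Psi> = \<Delta>"
      and \<Gamma>': "replaces A \<Delta> \<Gamma> \<Gamma>'"
      using \<Phi>' unfolding RImp replaces_append replaces_single by blast
    have 1: "nameless \<sigma> \<Gamma>' B1"
      using minor RImp(1) \<Gamma>' by blast
    have 2: "nameless \<sigma> (\<Gamma>L @ [B2] @ \<Gamma>R) C"
      using major_refl RImp(3) by blast
    have left: "nameless \<sigma> (\<Gamma>L @ [RImp B1 B2] @ \<Gamma>' @ \<Gamma>R) C"
      if "wf_nameless (\<Gamma>L @ [RImp B1 B2] @ \<Gamma>' @ \<Gamma>R) C"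
      using nameless.left[OF left_rule.RImp[of \<sigma> \<Gamma>' B1 B2], of \<Gamma>L \<Gamma>R C] 1 2 that by simp
    \<comment> \<open>In this mixed context \<Gamma>' is covered by the first assumption in
      \<open>wf\<close>, while the implication is covered by the second.\<close>
    have wf': "wf_nameless (\<Gamma>L @ [RImp B1 B2] @ \<Gamma>' @ \<Gamma>R) C"
      using wf \<Phi>'_eq RImp(2) unfolding wf_nameless_def by auto
    from \<Psi> show ?thesis
    proof
      assume "\<Psi> = [RImp B1 B2]"
      then show ?thesis
        using left wf' \<Phi>'_eq by simp
    next
      assume A: "RImp B1 B2 = A \<and> \<Psi> = \<Delta>"
      have "nameless \<sigma> (\<Gamma>L @ \<Delta> @ \<Gamma>' @ \<Gamma>R) C"
      proof (rule cut_at_right_rule[OF \<Delta>])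
        show "nameless \<sigma> (\<Gamma>L @ [A] @ \<Gamma>' @ \<Gamma>R) C"
          using left wf' A by simp
        fix S' \<Gamma>\<^sub>0
        assume "right_rule S' \<Gamma>\<^sub>0 A" "\<And>\<Theta> D. (\<Theta>, D) \<in> S' \<Longrightarrow> nameless \<sigma> \<Theta> D"
        then have 3: "nameless \<sigma> (\<Gamma>\<^sub>0 @ [B1]) B2"
          using A by (auto elim!: right_RImpE)
        \<comment> \<open>Cutting on \<open>B2\<close> first exposes the argument \<open>B1\<close>
          exactly where \<Gamma>' has to go; the second cut is on \<open>B1\<close>.\<close>
        have "nameless \<sigma> ((\<Gamma>L @ \<Gamma>\<^sub>0) @ [B1] @ \<Gamma>R) C"
          using cut_admissibleD[OF sub 3 2] A by auto
        then show "nameless \<sigma> (\<Gamma>L @ \<Gamma>\<^sub>0 @ \<Gamma>' @ \<Gamma>R) C"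
          using cut_admissibleD[OF sub 1, of "\<Gamma>L @ \<Gamma>\<^sub>0" \<Gamma>R C] A by auto
      qed
      then show ?thesis using \<Phi>'_eq A by simp
    qed
  next
    case (LImp \<Gamma> B1 B2)
    then obtain \<Psi> \<Gamma>' where \<Phi>'_eq: "\<Phi>' = \<Gamma>' @ \<Psi>" and \<Psi>: "\<Psi> = [LImp B1 B2] \<or> LImp B1 B2 = A \<and> \<Psi> = \<Delta>"
      and \<Gamma>': "replaces A \<Delta> \<Gamma> \<Gamma>'"
      using \<Phi>' unfolding LImp replaces_append replaces_single by blast
    have 1: "nameless \<sigma> \<Gamma>' B1"
      using minor LImp(1) \<Gamma>' by blast
    have 2: "nameless \<sigma> (\<Gamma>L @ [B2] @ \<Gamma>R) C"
      using major_refl LImp(3) by blast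
    have left: "nameless \<sigma> (\<Gamma>L @ \<Gamma>' @ [LImp B1 B2] @ \<Gamma>R) C"
      if "wf_nameless (\<Gamma>L @ \<Gamma>' @ [LImp B1 B2] @ \<Gamma>R) C"
      using nameless.left[OF left_rule.LImp[of \<sigma> \<Gamma>' B1 B2], of \<Gamma>L \<Gamma>R C] 1 2 that by simp
    have wf': "wf_nameless (\<Gamma>L @ \<Gamma>' @ [LImp B1 B2] @ \<Gamma>R) C"
      using wf \<Phi>'_eq LImp(2) unfolding wf_nameless_def by auto
    from \<Psi> show ?thesis
    proof
      assume "\<Psi> = [LImp B1 B2]"
      then show ?thesis
        using left wf' \<Phi>'_eq by simp
    next
      assume A: "LImp B1 B2 = A \<and> \<Psi> = \<Delta>"
      have "nameless \<sigma> ((\<Gamma>L @ \<Gamma>') @ \<Delta> @ \<Gamma>R) C"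
      proof (rule cut_at_right_rule[OF \<Delta>])
        show "nameless \<sigma> ((\<Gamma>L @ \<Gamma>') @ [A] @ \<Gamma>R) C"
          using left wf' A by simp
        fix S' \<Gamma>\<^sub>0
        assume "right_rule S' \<Gamma>\<^sub>0 A" "\<And>\<Theta> D. (\<Theta>, D) \<in> S' \<Longrightarrow> nameless \<sigma> \<Theta> D"
        then have 3: "nameless \<sigma> ([B1] @ \<Gamma>\<^sub>0) B2"
          using A by (auto elim!: right_LImpE)
        \<comment> \<open>Mirror image: the cut on \<open>B2\<close> now exposes \<open>B1\<close>
          to the left of \<open>\<Gamma>\<^sub>0\<close>.\<close>
        have "nameless \<sigma> (\<Gamma>L @ [B1] @ \<Gamma>\<^sub>0 @ \<Gamma>R) C"
          using cut_admissibleD[OF sub 3 2] A by auto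
        then show "nameless \<sigma> ((\<Gamma>L @ \<Gamma>') @ \<Gamma>\<^sub>0 @ \<Gamma>R) C"
          using cut_admissibleD[OF sub 1, of "\<Gamma>L" "\<Gamma>\<^sub>0 @ \<Gamma>R" C] A by auto
      qed
      then show ?thesis using \<Phi>'_eq A by simp
    qed
  next
    \<comment> \<open>In the structural cases \<open>B\<close> becomes a block
      \<open>\<Psi>\<close>, either \<open>[B]\<close> itself or \<Delta>, and the rule on
      \<open>B\<close> becomes the corresponding block rule.\<close>
    case (mobility_left B \<Gamma>)
    then obtain \<Psi> \<Gamma>' where eq: "\<Phi>' = \<Psi> @ \<Gamma>'" and \<Psi>: "replaces A \<Delta> [B] \<Psi>"
      and \<Gamma>': "replaces A \<Delta> \<Gamma> \<Gamma>'"
      using \<Phi>' unfolding mobility_left replaces_append by blast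
    have "nameless \<sigma> (\<Gamma>L @ (\<Gamma>' @ \<Psi>) @ \<Gamma>R) C"
      by (rule major[OF _ replaces_appendI[OF \<Gamma>' \<Psi>]]) (simp add: mobility_left(3))
    moreover have "\<forall>B \<in> set \<Psi>. MLeft \<in> \<sigma> (mode_of B)"
      using \<Psi> \<sigma>_\<Delta> mobility_left(4) by auto
    ultimately show ?thesis
      using block_mobility_left[of \<sigma> \<Gamma>L \<Gamma>' \<Psi> \<Gamma>R C] eq by simp
  next
    case (mobility_right B \<Gamma>)
    then obtain \<Psi> \<Gamma>' where eq: "\<Phi>' = \<Gamma>' @ \<Psi>" and \<Psi>: "replaces A \<Delta> [B] \<Psi>"
      and \<Gamma>': "replaces A \<Delta> \<Gamma> \<Gamma>'"
      using \<Phi>' unfolding mobility_right replaces_append by blast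
    have "nameless \<sigma> (\<Gamma>L @ (\<Psi> @ \<Gamma>') @ \<Gamma>R) C"
      by (rule major[OF _ replaces_appendI[OF \<Psi> \<Gamma>']]) (simp add: mobility_right(3))
    moreover have "\<forall>B \<in> set \<Psi>. MRight \<in> \<sigma> (mode_of B)"
      using \<Psi> \<sigma>_\<Delta> mobility_right(4) by auto
    ultimately show ?thesis
      using block_mobility_right[of \<sigma> \<Gamma>L \<Psi> \<Gamma>' \<Gamma>R C] eq by simp
  next
    case (contraction_left B \<Gamma>)
    then obtain \<Psi> \<Gamma>' where eq: "\<Phi>' = \<Psi> @ \<Gamma>'" and \<Psi>: "replaces A \<Delta> [B] \<Psi>"
      and \<Gamma>': "replaces A \<Delta> \<Gamma> \<Gamma>'"
      using \<Phi>' unfolding contraction_left replaces_append by blast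
    \<comment> \<open>Both copies of \<open>B\<close> are replaced by the same block in a single use
      of the induction hypothesis, which a cut on one occurrence could not do.\<close>
    have "nameless \<sigma> (\<Gamma>L @ (\<Psi> @ \<Gamma>' @ \<Psi>) @ \<Gamma>R) C"
      by (rule major[OF _ replaces_appendI[OF \<Psi> replaces_appendI[OF \<Gamma>' \<Psi>]]]) (simp add: contraction_left(3))
    moreover have "\<forall>B \<in> set \<Psi>. CLeft \<in> \<sigma> (mode_of B)"
      using \<Psi> \<sigma>_\<Delta> contraction_left(4) by auto
    ultimately show ?thesis
      using block_contraction_left[of \<sigma> \<Gamma>L \<Psi> \<Gamma>' \<Gamma>R C] eq by simp
  next
    case (contraction_right B \<Gamma>)
    then obtain \<Psi> \<Gamma>' where eq: "\<Phi>' = \<Gamma>' @ \<Psi>" and \<Psi>: "replaces A \<Delta> [B] \<Psi>"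
      and \<Gamma>': "replaces A \<Delta> \<Gamma> \<Gamma>'"
      using \<Phi>' unfolding contraction_right replaces_append by blast
    have "nameless \<sigma> (\<Gamma>L @ (\<Psi> @ \<Gamma>' @ \<Psi>) @ \<Gamma>R) C"
      by (rule major[OF _ replaces_appendI[OF \<Psi> replaces_appendI[OF \<Gamma>' \<Psi>]]]) (simp add: contraction_right(3))
    moreover have "\<forall>B \<in> set \<Psi>. CRight \<in> \<sigma> (mode_of B)"
      using \<Psi> \<sigma>_\<Delta> contraction_right(4) by auto
    ultimately show ?thesis
      using block_contraction_right[of \<sigma> \<Gamma>L \<Psi> \<Gamma>' \<Gamma>R C] eq by simp
  next
    case (weakening B)
    have "nameless \<sigma> (\<Gamma>L @ \<Gamma>R) C"
      using major_refl weakening(3) by fastforce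
    moreover have "\<forall>B \<in> set \<Phi>'. Wk \<in> \<sigma> (mode_of B)"
      using \<Phi>' weakening(2,4) \<sigma>_\<Delta> by auto
    ultimately show ?thesis
      using block_weakening wf by blast
  qed
qed

lemma multicut:
  fixes \<sigma> :: "'m::preorder \<Rightarrow> structural set" and A :: "('m, 'p) fm"
  assumes mono: "\<And>k m. k \<ge> m \<Longrightarrow> \<sigma> k \<supseteq> \<sigma> m"
    and sub: "\<And>B :: ('m, 'p) fm. size B < size A \<Longrightarrow> cut_admissible \<sigma> B"
    and \<Delta>: "nameless \<sigma> \<Delta> A"
    and "nameless \<sigma> \<Gamma> C" "replaces A \<Delta> \<Gamma> \<Gamma>'"
  shows "nameless \<sigma> \<Gamma>' C"
  using assms(4,5)
proof (induction arbitrary: \<Gamma>' rule: nameless.induct)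
  case (id B)
  then show ?case
    using \<Delta> nameless.id by (auto simp: replaces_single)
next
  case (right S \<Gamma> C)
  obtain S' where S': "right_rule S' \<Gamma>' C"
    "\<And>\<Theta>' B. (\<Theta>', B) \<in> S' \<Longrightarrow> \<exists>\<Theta>. (\<Theta>, B) \<in> S \<and> replaces A \<Delta> \<Theta> \<Theta>'"
    using right_rule_replaces[OF right.hyps(1) right.prems] by blast
  show ?case
    using S' right.IH wf_nameless_replaces[OF right.prems nameless_wf[OF \<Delta>] right.hyps(3)]
    by (intro nameless.right[OF S'(1)]) blast+
next
  case (left S \<Phi> T \<Gamma>L \<Gamma>R C)
  obtain \<Gamma>L' \<Phi>' \<Gamma>R' where \<Gamma>': "\<Gamma>' = \<Gamma>L' @ \<Phi>' @ \<Gamma>R'"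
    and r: "replaces A \<Delta> \<Gamma>L \<Gamma>L'" "replaces A \<Delta> \<Phi> \<Phi>'" "replaces A \<Delta> \<Gamma>R \<Gamma>R'"
    using left.prems unfolding replaces_append by blast
  note wf = wf_nameless_replaces[OF _ nameless_wf[OF \<Delta>] left.hyps(4)]
  show ?case
    unfolding \<Gamma>'
  proof (rule multicut_left[OF mono sub \<Delta> left.hyps(1)])
    show "nameless \<sigma> \<Theta>' B" if "(\<Theta>, B) \<in> S" "replaces A \<Delta> \<Theta> \<Theta>'" for \<Theta> B \<Theta>'
      using left.IH(1) that by blast
    show "nameless \<sigma> (\<Gamma>L' @ \<Theta>' @ \<Gamma>R') C" if "\<Theta> \<in> T" "replaces A \<Delta> \<Theta> \<Theta>'" for \<Theta> \<Theta>'
      using left.IH(2)[OF that(1)] that(2) r replaces_appendI by metis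
    show "wf_nameless (\<Gamma>L' @ \<Phi>' @ \<Gamma>R') C"
      using wf left.prems \<Gamma>' by blast
    show "wf_nameless (\<Gamma>L' @ \<Phi> @ \<Gamma>R') C"
      using wf r replaces_appendI replaces_refl by metis
    show "replaces A \<Delta> \<Phi> \<Phi>'"
      by (rule r)
  qed
qed

text \<open>Induction on the size of the cut formula. A plain cut is the multicut selecting just the
  displayed occurrence; any other occurrences of \<open>A\<close> in \<Gamma>L or \<Gamma>R are
  kept.\<close>

lemma cut_admissible:
  fixes \<sigma> :: "'m::preorder \<Rightarrow> structural set" and A :: "('m, 'p) fm"
  assumes mono: "\<And>k m. k \<ge> m \<Longrightarrow> \<sigma> k \<supseteq> \<sigma> m"
  shows "cut_admissible \<sigma> A"
proof (induction A rule: measure_induct_rule[of size])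
  case (less A)
  have "replaces A \<Delta> (\<Gamma>L @ [A] @ \<Gamma>R) (\<Gamma>L @ \<Delta> @ \<Gamma>R)" for \<Delta> \<Gamma>L \<Gamma>R
    by (intro replaces_appendI replaces_refl) (simp add: replaces_single)
  then show ?case
    unfolding cut_admissible_def using multicut[OF mono less] by blast
qed

section \<open>Erasing and restoring names\<close>

lemma wf_seq_nameless: "wf_seq \<Omega> C \<longleftrightarrow> wf_ctx \<Omega> \<and> wf_nameless (map snd \<Omega>) C"
  by (auto simp: wf_seq_def wf_nameless_def wf_ctx_def ctx_ge_def)

text \<open>Erasure removes cuts together with names: every rule other than cut maps to its nameless
  counterpart.\<close>

lemma nameless_of_deriv:
  assumes mono: "\<And>k m. k \<ge> m \<Longrightarrow> \<sigma> k \<supseteq> \<sigma> m"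
    and "deriv c \<sigma> \<Omega> C"
  shows "nameless \<sigma> (map snd \<Omega>) C"
  using assms(2)
proof (induction rule: deriv.induct)
  case (id x A)
  then show ?case by (auto simp: wf_seq_def intro: nameless.id)
next
  \<comment> \<open>Admissibility of cut, and with it monotonicity of \<sigma>, is applied
    here.\<close>
  case (cut \<Omega>A A \<Omega>L x \<Omega>R C)
  then show ?case
    using cut_admissibleD[OF cut_admissible[OF mono]] by fastforce
next
  case (UnitR m)
  have "nameless \<sigma> [] (Unit m)"
    by (rule nameless.right[OF right_rule.Unit]) (auto simp: wf_nameless_def)
  then show ?case by simp
next
  case (FuseR \<Omega>1 A \<Omega>2 B)
  show ?case
    by (rule nameless.right[OF right_rule.Fuse[of "map snd \<Omega>1" A "map snd \<Omega>2" B], folded map_append])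
      (use FuseR in \<open>auto simp: wf_seq_nameless\<close>)
next
  case (OplusR1 \<Omega> A B)
  show ?case
    by (rule nameless.right[OF right_rule.Oplus1]) (use OplusR1 in \<open>auto simp: wf_seq_nameless\<close>)
next
  case (OplusR2 \<Omega> B A)
  show ?case
    by (rule nameless.right[OF right_rule.Oplus2]) (use OplusR2 in \<open>auto simp: wf_seq_nameless\<close>)
next
  case (DownR \<Omega> A m)
  show ?case
    by (rule nameless.right[OF right_rule.Down]) (use DownR in \<open>auto simp: wf_seq_nameless\<close>)
next
  case (RImpR \<Omega> x A B)
  show ?case
    by (rule nameless.right[OF right_rule.RImp]) (use RImpR in \<open>auto simp: wf_seq_nameless\<close>)
next
  case (LImpR x A \<Omega> B)
  show ?case
    by (rule nameless.right[OF right_rule.LImp]) (use LImpR in \<open>auto simp: wf_seq_nameless\<close>)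
next
  case (WithR \<Omega> A B)
  show ?case
    by (rule nameless.right[OF right_rule.With]) (use WithR in \<open>auto simp: wf_seq_nameless\<close>)
next
  case (UpR \<Omega> A m)
  show ?case
    by (rule nameless.right[OF right_rule.Up]) (use UpR in \<open>auto simp: wf_seq_nameless\<close>)
next
  case (UnitL \<Omega>L \<Omega>R C m x)
  then show ?case
    using nameless_left1[OF left_rule.Unit, of _ "map snd \<Omega>L" "map snd \<Omega>R"]
    by (auto simp: wf_seq_nameless)
next
  case (FuseL \<Omega>L x1 A x2 B \<Omega>R C x)
  then show ?case
    using nameless_left1[OF left_rule.Fuse, of _ "map snd \<Omega>L" A B "map snd \<Omega>R"]
    by (auto simp: wf_seq_nameless)
next
  case (OplusL \<Omega>L y A \<Omega>R C B x)
  have "nameless \<sigma> (map snd \<Omega>L @ [Oplus A B] @ map snd \<Omega>R) C"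
    by (rule nameless.left[OF left_rule.Oplus]) (use OplusL in \<open>auto simp: wf_seq_nameless\<close>)
  then show ?case by simp
next
  case (DownL \<Omega>L y A \<Omega>R C x m)
  then show ?case
    using nameless_left1[OF left_rule.Down, of _ "map snd \<Omega>L" A "map snd \<Omega>R"]
    by (auto simp: wf_seq_nameless)
next
  case (WithL1 \<Omega>L y A \<Omega>R C x B)
  then show ?case
    using nameless_left1[OF left_rule.With1, of _ "map snd \<Omega>L" A "map snd \<Omega>R"]
    by (auto simp: wf_seq_nameless)
next
  case (WithL2 \<Omega>L y B \<Omega>R C x A)
  then show ?case
    using nameless_left1[OF left_rule.With2, of _ "map snd \<Omega>L" B "map snd \<Omega>R"]
    by (auto simp: wf_seq_nameless)
next
  case (UpL \<Omega>L y A \<Omega>R C x m)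
  then show ?case
    using nameless_left1[OF left_rule.Up, of _ "map snd \<Omega>L" A "map snd \<Omega>R"]
    by (auto simp: wf_seq_nameless)
next
  case (RImpL \<Omega>A A \<Omega>L y B \<Omega>R C f)
  have "nameless \<sigma> (map snd \<Omega>L @ ([RImp A B] @ map snd \<Omega>A) @ map snd \<Omega>R) C"
    by (rule nameless.left[OF left_rule.RImp]) (use RImpL in \<open>auto simp: wf_seq_nameless\<close>)
  then show ?case by simp
next
  case (LImpL \<Omega>A A \<Omega>L y B \<Omega>R C f)
  have "nameless \<sigma> (map snd \<Omega>L @ (map snd \<Omega>A @ [LImp A B]) @ map snd \<Omega>R) C"
    by (rule nameless.left[OF left_rule.LImp]) (use LImpL in \<open>auto simp: wf_seq_nameless\<close>)
  then show ?case by simp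
next
  case (mobility_left \<Omega>L \<Omega>M x A \<Omega>R C)
  then show ?case
    using nameless_left1[OF left_rule.mobility_left, of \<sigma> A "map snd \<Omega>L" "map snd \<Omega>M" "map snd \<Omega>R"]
    by (auto simp: wf_seq_nameless)
next
  case (mobility_right \<Omega>L x A \<Omega>M \<Omega>R C)
  then show ?case
    using nameless_left1[OF left_rule.mobility_right, of \<sigma> A "map snd \<Omega>L" "map snd \<Omega>M" "map snd \<Omega>R"]
    by (auto simp: wf_seq_nameless)
next
  case (contraction_left \<Omega>L x A \<Omega>M \<Omega>R C)
  then show ?case
    using nameless_left1[OF left_rule.contraction_left, of \<sigma> A "map snd \<Omega>L" "map snd \<Omega>M" "map snd \<Omega>R"]
    by (auto simp: wf_seq_nameless)
next
  case (contraction_right \<Omega>L x A \<Omega>M \<Omega>R C)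
  then show ?case
    using nameless_left1[OF left_rule.contraction_right, of \<sigma> A "map snd \<Omega>L" "map snd \<Omega>M" "map snd \<Omega>R"]
    by (auto simp: wf_seq_nameless)
next
  case (weakening \<Omega>L \<Omega>R C A x)
  then show ?case
    using nameless_left1[OF left_rule.weakening, of \<sigma> A "map snd \<Omega>L" "map snd \<Omega>R"]
    by (auto simp: wf_seq_nameless)
qed

section \<open>Restoring names\<close>

lemma wf_ctx_subset: "wf_ctx \<Omega> \<Longrightarrow> set \<Omega>' \<subseteq> set \<Omega> \<Longrightarrow> wf_ctx \<Omega>'"
  unfolding wf_ctx_def by (meson subsetD)

text \<open>A fresh name clashes with no existing label. Bounding only the set of entries of
  \<Omega>' covers every position of the new antecedent and the deletion of the principal
  one.\<close>

lemma wf_ctx_fresh: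
  assumes "wf_ctx \<Omega>" "y \<notin> vars \<Omega>" "wf_fm A" "set \<Omega>' \<subseteq> insert (y, A) (set \<Omega>)"
  shows "wf_ctx \<Omega>'"
proof -
  have "wf_ctx ((y, A) # \<Omega>)"
    using assms(1-3) by (auto simp: wf_ctx_def vars_def image_iff)
  then show ?thesis
    using wf_ctx_subset assms(4) by fastforce
qed

lemma finite_vars: "finite (vars \<Omega>)"
  unfolding vars_def by simp

lemma fresh_var: obtains y where "y \<notin> vars \<Omega>"
  using ex_new_if_finite[OF infinite_UNIV_nat finite_vars] by blast

lemma ctx_ge_of_nameless: "wf_nameless (map snd \<Omega>) A \<Longrightarrow> ctx_ge \<Omega> (mode_of A)"
  unfolding wf_nameless_def ctx_ge_def by auto

text \<open>Premises are assumed under every consistent naming, so logical rules can pick fresh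
  names and structural rules can reuse old ones. The \<open>ctx_ge\<close> conjuncts return the mode
  conditions that the nameless rules leave implicit.\<close>

lemma deriv_left_rule:
  assumes rule: "left_rule \<sigma> S (map snd \<Omega>M) T"
    and minor: "\<And>\<Omega> B. \<lbrakk>(map snd \<Omega>, B) \<in> S; wf_ctx \<Omega>\<rbrakk> \<Longrightarrow> deriv c \<sigma> \<Omega> B \<and> ctx_ge \<Omega> (mode_of B)"
    and major: "\<And>\<Omega>. \<lbrakk>map snd \<Omega> \<in> T; wf_ctx (\<Omega>L @ \<Omega> @ \<Omega>R)\<rbrakk>
      \<Longrightarrow> deriv c \<sigma> (\<Omega>L @ \<Omega> @ \<Omega>R) C \<and> ctx_ge (\<Omega>L @ \<Omega> @ \<Omega>R) (mode_of C)"
    and wf: "wf_seq (\<Omega>L @ \<Omega>M @ \<Omega>R) C"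
  shows "deriv c \<sigma> (\<Omega>L @ \<Omega>M @ \<Omega>R) C"
proof -
  let ?\<Omega> = "\<Omega>L @ \<Omega>M @ \<Omega>R"
  have ctx: "wf_ctx ?\<Omega>"
    using wf by (simp add: wf_seq_def)
  have fm: "wf_fm A" if "A \<in> set (map snd \<Omega>M)" for A
    using ctx that by (auto simp: wf_ctx_def)
  obtain y where y: "y \<notin> vars ?\<Omega>"
    by (rule fresh_var)
  have fresh: "deriv c \<sigma> (\<Omega>L @ [(y, A)] @ \<Omega>R) C \<and> ctx_ge (\<Omega>L @ [(y, A)] @ \<Omega>R) (mode_of C)"
    if "[A] \<in> T" "wf_fm A" for A
    using that by (intro major wf_ctx_fresh[OF ctx y]) auto
  from rule show ?thesis
  proof cases
    case (Unit m)
    then obtain x where x: "\<Omega>M = [(x, Unit m)]" by auto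
    have "deriv c \<sigma> (\<Omega>L @ [] @ \<Omega>R) C"
      using Unit by (intro major[THEN conjunct1] wf_ctx_subset[OF ctx]) auto
    then show ?thesis
      using deriv.UnitL wf x by fastforce
  next
    case (Fuse A B)
    then obtain x where x: "\<Omega>M = [(x, Fuse A B)]" by auto
    \<comment> \<open>Freshness for the context extended by \<open>y\<close> also makes the two new
      names distinct.\<close>
    obtain z where "z \<notin> vars ((y, A) # ?\<Omega>)"
      by (rule fresh_var)
    then have z: "z \<noteq> y" "z \<notin> vars ?\<Omega>" "z \<notin> vars ([(y, A)] @ ?\<Omega>)"
      by (auto simp: vars_def)
    have AB: "wf_fm A" "wf_fm B"
      using fm x by auto
    have "wf_ctx ([(y, A)] @ ?\<Omega>)"
      using AB by (intro wf_ctx_fresh[OF ctx y, of A]) auto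
    then have "wf_ctx (\<Omega>L @ [(y, A), (z, B)] @ \<Omega>R)"
      by (rule wf_ctx_fresh[OF _ z(3) AB(2)]) auto
    then have d: "deriv c \<sigma> (\<Omega>L @ [(y, A), (z, B)] @ \<Omega>R) C"
      using Fuse by (intro major[THEN conjunct1]) auto
    show ?thesis
      using wf y z(1,2) unfolding x by (intro deriv.FuseL[OF d]) auto
  next
    case (Oplus A B)
    then obtain x where x: "\<Omega>M = [(x, Oplus A B)]" by auto
    show ?thesis
      using wf y fresh[of A] fresh[of B] fm Oplus(3) unfolding x by (intro deriv.OplusL) auto
  next
    case (Down m A)
    then obtain x where x: "\<Omega>M = [(x, Down m A)]" by auto
    show ?thesis
      using wf y fresh[of A] fm Down(3) unfolding x by (intro deriv.DownL) auto
  next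
    case (With1 A B)
    then obtain x where x: "\<Omega>M = [(x, With A B)]" by auto
    show ?thesis
      using wf y fresh[of A] fm With1(3) unfolding x by (intro deriv.WithL1) auto
  next
    case (With2 A B)
    then obtain x where x: "\<Omega>M = [(x, With A B)]" by auto
    show ?thesis
      using wf y fresh[of B] fm With2(3) unfolding x by (intro deriv.WithL2) auto
  next
    case (Up m A)
    then obtain x where x: "\<Omega>M = [(x, Up m A)]" by auto
    have A: "deriv c \<sigma> (\<Omega>L @ [(y, A)] @ \<Omega>R) C" "ctx_ge (\<Omega>L @ [(y, A)] @ \<Omega>R) (mode_of C)"
      using fresh[of A] fm Up(3) x by auto
    \<comment> \<open>Read off at the antecedent \<open>(y, A)\<close>: this is the mode condition
      of \<open>UpL\<close>.\<close>
    then have "mode_of C \<le> mode_of A"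
      by (auto simp: ctx_ge_def)
    with A show ?thesis
      using wf y unfolding x by (intro deriv.UpL) auto
  next
    case (RImp \<Gamma> A B)
    then obtain x \<Omega>A where x: "\<Omega>M = [(x, RImp A B)] @ \<Omega>A" "map snd \<Omega>A = \<Gamma>"
      by auto
    have "wf_ctx \<Omega>A"
      using x by (intro wf_ctx_subset[OF ctx]) auto
    then have A: "deriv c \<sigma> \<Omega>A A" "ctx_ge \<Omega>A (mode_of A)"
      using minor[of \<Omega>A A] RImp(1) x(2) by auto
    have B: "deriv c \<sigma> (\<Omega>L @ [(y, B)] @ \<Omega>R) C"
      using fresh[of B] fm[of "RImp A B"] RImp(3) x by auto
    have "deriv c \<sigma> (\<Omega>L @ [(x, RImp A B)] @ \<Omega>A @ \<Omega>R) C"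
      using wf y unfolding x by (intro deriv.RImpL[OF A B]) auto
    then show ?thesis using x by simp
  next
    case (LImp \<Gamma> A B)
    then obtain x \<Omega>A where x: "\<Omega>M = \<Omega>A @ [(x, LImp A B)]" "map snd \<Omega>A = \<Gamma>"
      by (auto simp: map_eq_append_conv)
    have "wf_ctx \<Omega>A"
      using x by (intro wf_ctx_subset[OF ctx]) auto
    then have A: "deriv c \<sigma> \<Omega>A A" "ctx_ge \<Omega>A (mode_of A)"
      using minor[of \<Omega>A A] LImp(1) x(2) by auto
    have B: "deriv c \<sigma> (\<Omega>L @ [(y, B)] @ \<Omega>R) C"
      using fresh[of B] fm[of "LImp A B"] LImp(3) x by auto
    have "deriv c \<sigma> (\<Omega>L @ \<Omega>A @ [(x, LImp A B)] @ \<Omega>R) C"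
      using wf y unfolding x by (intro deriv.LImpL[OF A B]) auto
    then show ?thesis using x by simp
  next
    case (mobility_left A \<Gamma>)
    then obtain x \<Omega>A where x: "\<Omega>M = [(x, A)] @ \<Omega>A" "map snd \<Omega>A = \<Gamma>"
      by auto
    have "deriv c \<sigma> (\<Omega>L @ (\<Omega>A @ [(x, A)]) @ \<Omega>R) C"
      using x mobility_left by (intro major[THEN conjunct1] wf_ctx_subset[OF ctx]) auto
    then show ?thesis
      using deriv.mobility_left[of c \<sigma> \<Omega>L \<Omega>A x A \<Omega>R C] mobility_left(4) wf x(1) by simp
  next
    case (mobility_right A \<Gamma>)
    then obtain x \<Omega>A where x: "\<Omega>M = \<Omega>A @ [(x, A)]" "map snd \<Omega>A = \<Gamma>"
      by (auto simp: map_eq_append_conv)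
    have "deriv c \<sigma> (\<Omega>L @ ([(x, A)] @ \<Omega>A) @ \<Omega>R) C"
      using x mobility_right by (intro major[THEN conjunct1] wf_ctx_subset[OF ctx]) auto
    then show ?thesis
      using deriv.mobility_right[of c \<sigma> \<Omega>L x A \<Omega>A \<Omega>R C] mobility_right(4) wf x(1) by simp
  next
    case (contraction_left A \<Gamma>)
    then obtain x \<Omega>A where x: "\<Omega>M = [(x, A)] @ \<Omega>A" "map snd \<Omega>A = \<Gamma>"
      by auto
    \<comment> \<open>Repeating \<open>x\<close> leaves the set of entries unchanged, so the
      labelling stays consistent.\<close>
    have "deriv c \<sigma> (\<Omega>L @ ([(x, A)] @ \<Omega>A @ [(x, A)]) @ \<Omega>R) C"
      using x contraction_left by (intro major[THEN conjunct1] wf_ctx_subset[OF ctx]) auto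
    then show ?thesis
      using deriv.contraction_left[of c \<sigma> \<Omega>L x A \<Omega>A \<Omega>R C] contraction_left(4) wf x(1) by simp
  next
    case (contraction_right A \<Gamma>)
    then obtain x \<Omega>A where x: "\<Omega>M = \<Omega>A @ [(x, A)]" "map snd \<Omega>A = \<Gamma>"
      by (auto simp: map_eq_append_conv)
    have "deriv c \<sigma> (\<Omega>L @ ([(x, A)] @ \<Omega>A @ [(x, A)]) @ \<Omega>R) C"
      using x contraction_right by (intro major[THEN conjunct1] wf_ctx_subset[OF ctx]) auto
    then show ?thesis
      using deriv.contraction_right[of c \<sigma> \<Omega>L x A \<Omega>A \<Omega>R C] contraction_right(4) wf x(1) by simp
  next
    case (weakening A)
    then obtain x where x: "\<Omega>M = [(x, A)]" by auto
    have "deriv c \<sigma> (\<Omega>L @ [] @ \<Omega>R) C"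
      using weakening by (intro major[THEN conjunct1] wf_ctx_subset[OF ctx]) auto
    then show ?thesis
      using deriv.weakening[of c \<sigma> \<Omega>L \<Omega>R C A x] weakening(4) wf x by simp
  qed
qed

text \<open>Induction with the naming general, so that each premise can be named as its rule
  demands. No step uses cut, hence the flag \<open>c\<close> is arbitrary and can later be
  \<open>False\<close>.\<close>

lemma deriv_of_nameless:
  assumes "nameless \<sigma> (map snd \<Omega>) C" "wf_ctx \<Omega>"
  shows "deriv c \<sigma> \<Omega> C"
  using assms
proof (induction "map snd \<Omega>" C arbitrary: \<Omega> rule: nameless.induct)
  case (id A)
  then obtain x where "\<Omega> = [(x, A)]" by auto
  with id show ?case
    by (auto intro!: deriv.id simp: wf_seq_def ctx_ge_def)
next
  case (right S C)
  have wf: "wf_seq \<Omega> C"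
    using right by (simp add: wf_seq_nameless)
  have prem: "deriv c \<sigma> \<Omega>' B" if "(map snd \<Omega>', B) \<in> S" "wf_ctx \<Omega>'" for \<Omega>' B
    using right that by blast
  obtain x where x: "x \<notin> vars \<Omega>"
    by (rule fresh_var)
  from right(1) show ?case
  proof cases
    case (Unit m)
    then show ?thesis using deriv.UnitR by simp
  next
    case (Fuse \<Gamma>1 A \<Gamma>2 B)
    then obtain \<Omega>1 \<Omega>2 where \<Omega>: "\<Omega> = \<Omega>1 @ \<Omega>2" "map snd \<Omega>1 = \<Gamma>1" "map snd \<Omega>2 = \<Gamma>2"
      by (auto simp: map_eq_append_conv)
    have "wf_ctx \<Omega>1" "wf_ctx \<Omega>2"
      using \<Omega> by (auto intro!: wf_ctx_subset[OF right.prems])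
    then show ?thesis
      using prem wf Fuse \<Omega> by (auto intro!: deriv.FuseR)
  next
    case (Oplus1 A B)
    then show ?thesis using prem right.prems wf by (auto intro!: deriv.OplusR1)
  next
    case (Oplus2 B A)
    then show ?thesis using prem right.prems wf by (auto intro!: deriv.OplusR2)
  next
    case (Down A m)
    \<comment> \<open>The condition of \<open>DownR\<close> is recovered from the well-formedness of
      the premise.\<close>
    then have "ctx_ge \<Omega> (mode_of A)"
      using right.hyps(2) by (intro ctx_ge_of_nameless nameless_wf[of \<sigma>]) auto
    then show ?thesis using prem right.prems wf Down by (auto intro!: deriv.DownR)
  next
    case (RImp A B)
    then have "wf_ctx (\<Omega> @ [(x, A)])"
      using wf by (intro wf_ctx_fresh[OF right.prems x, of A]) (auto simp: wf_seq_def)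
    then have "deriv c \<sigma> (\<Omega> @ [(x, A)]) B"
      using RImp by (intro prem) auto
    then show ?thesis using RImp x wf by (auto intro!: deriv.RImpR)
  next
    case (LImp A B)
    then have "wf_ctx ([(x, A)] @ \<Omega>)"
      using wf by (intro wf_ctx_fresh[OF right.prems x, of A]) (auto simp: wf_seq_def)
    then have "deriv c \<sigma> ([(x, A)] @ \<Omega>) B"
      using LImp by (intro prem) auto
    then show ?thesis using LImp x wf by (auto intro!: deriv.LImpR)
  next
    case (With A B)
    then show ?thesis using prem right.prems wf by (auto intro!: deriv.WithR)
  next
    case (Up A m)
    then show ?thesis using prem right.prems wf by (auto intro!: deriv.UpR)
  qed
next
  case (left S \<Phi> T \<Gamma>L \<Gamma>R C)
  obtain \<Omega>L \<Omega>M \<Omega>R where \<Omega>: "\<Omega> = \<Omega>L @ \<Omega>M @ \<Omega>R"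
    and \<Gamma>: "map snd \<Omega>L = \<Gamma>L" "map snd \<Omega>M = \<Phi>" "map snd \<Omega>R = \<Gamma>R"
    using left.hyps(7) by (auto simp: append_eq_map_conv)
  show ?case
    unfolding \<Omega>
  proof (rule deriv_left_rule)
    show "left_rule \<sigma> S (map snd \<Omega>M) T"
      using left.hyps(1) \<Gamma> by simp
    show "deriv c \<sigma> \<Omega>' B \<and> ctx_ge \<Omega>' (mode_of B)"
      if "(map snd \<Omega>', B) \<in> S" "wf_ctx \<Omega>'" for \<Omega>' B
      using left.hyps(2,3) that nameless_wf ctx_ge_of_nameless by blast
    show "deriv c \<sigma> (\<Omega>L @ \<Omega>' @ \<Omega>R) C \<and> ctx_ge (\<Omega>L @ \<Omega>' @ \<Omega>R) (mode_of C)"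
      if "map snd \<Omega>' \<in> T" "wf_ctx (\<Omega>L @ \<Omega>' @ \<Omega>R)" for \<Omega>'
    proof -
      have eq: "\<Gamma>L @ map snd \<Omega>' @ \<Gamma>R = map snd (\<Omega>L @ \<Omega>' @ \<Omega>R)"
        using \<Gamma> by simp
      show ?thesis
        using left.hyps(5)[OF that(1) eq that(2)] left.hyps(4)[OF that(1)]
          ctx_ge_of_nameless nameless_wf unfolding eq by blast
    qed
    show "wf_seq (\<Omega>L @ \<Omega>M @ \<Omega>R) C"
      using left.hyps(6) left.prems \<Omega> \<Gamma> by (simp add: wf_seq_nameless)
  qed
qed

lemma deriv_wf_seq: "deriv c \<sigma> \<Omega> C \<Longrightarrow> wf_seq \<Omega> C"
proof (induction rule: deriv.induct)
  \<comment> \<open>Every other rule has the claim among its premises.\<close>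
  case (UnitR m)
  show ?case by (simp add: wf_seq_def wf_ctx_def ctx_ge_def)
qed

theorem theorem2:
  fixes \<sigma> :: "'m::preorder \<Rightarrow> structural set"
    and \<Omega> :: "('m, 'p) ctx" and C :: "('m, 'p) fm"
  assumes "\<And>k m. k \<ge> m \<Longrightarrow> \<sigma> k \<supseteq> \<sigma> m"
    and "derivable \<sigma> \<Omega> C"
  shows "cut_free_derivable \<sigma> \<Omega> C"
proof (rule deriv_of_nameless)
  show "nameless \<sigma> (map snd \<Omega>) C"
    using assms by (rule nameless_of_deriv)
  show "wf_ctx \<Omega>"
    using deriv_wf_seq[OF assms(2)] by (simp add: wf_seq_def)
qed

end
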